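(* Let $\theta\in\Theta\subset\mathbb R^{d_\theta}$ and $\beta\in\mathcal B\subset\mathbb R^{d_\beta}$ with $\mathcal B$ convex, and let $m:\mathcal W\times\Theta\times\mathcal B\to\mathbb R^{d_m}$ satisfy $\mathrm E_P[m(W;\theta_0,\beta_0)]=0$. Suppose $G_\beta=\partial_{\beta'}\mathrm E_P[m(W;\theta,\beta)]|_{(\theta_0,\beta_0)}$ exists, let $\Omega$ be a positive definite $d_m\times d_m$ matrix, $A$ a $d_m\times d_\theta$ matrix, $L:=\Omega^{-1/2}G_\beta$, $r_N>0$, and let $\gamma_0$ be a solution of $$\min\|\gamma\|_o\quad\text{such that}\quad\|A'\Omega^{-1/2}L-\gamma L'L\|_\infty\le r_N$$ for a norm $\|\cdot\|_o$, where $\|\cdot\|_\infty$ is the maximal absolute entry. Set $\mu_0:=A'\Omega^{-1}-\gamma_0L'\Omega^{-1/2}$, $\eta_0=(\beta_0',\mathrm{vec}(\mu_0)')'$, and $\psi(W;\theta,\eta)=\mu\,m(W;\theta,\beta)$ for $\eta=(\beta',\mathrm{vec}(\mu)')'\in\mathcal B\times\mathbb R^{d_\theta d_m}$. Then, for any sequence of positive constants $\lambda_N=o(N^{-1/2})$, $\psi$ is Neyman $\lambda_N$ near-orthogonal at $(\theta_0,\eta_0)$ with respect to the nuisance realization set $\mathcal T_N=\{\beta\in\mathcal B:\|\beta-\beta_0\|_1\le\lambda_N/r_N\}\times\mathbb R^{d_\theta d_m}$.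
   Context: A score $\psi$ obeys the Neyman $\lambda_N$ near-orthogonality condition at $(\theta_0,\eta_0)$ with respect to $\mathcal T_N\subset T$ if $\mathrm E_P[\psi(W;\theta_0,\eta_0)]=0$, the pathwise derivative $\mathrm D_r[\eta-\eta_0]:=\partial_r\mathrm E_P[\psi(W;\theta_0,\eta_0+r(\eta-\eta_0))]$ exists for all $r\in[0,1)$ and $\eta\in\mathcal T_N$, and $\|\mathrm D_0[\eta-\eta_0]\|\le\lambda_N$ for all $\eta\in\mathcal T_N$, where $(\lambda_N)$ is a sequence of positive constants with $\lambda_N=o(N^{-1/2})$. *)

theory Defs
  imports "HOL-Probability.Probability" "HOL-Library.Landau_Symbols"
begin

text \<open>Positive definite (symmetric) matrix.\<close>
definition pos_def_mat :: "real^'n^'n \<Rightarrow> bool" where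
  "pos_def_mat M \<longleftrightarrow> transpose M = M \<and> (\<forall>x. x \<noteq> 0 \<longrightarrow> x \<bullet> (M *v x) > 0)"

text \<open>The inverse symmetric square root of a positive definite matrix.\<close>
definition inv_sqrt_mat :: "real^'n^'n \<Rightarrow> real^'n^'n" where
  "inv_sqrt_mat M = (THE S. pos_def_mat S \<and> S ** S = matrix_inv M)"

text \<open>Maximal absolute entry of a matrix / vector, and the l1 norm of a vector.\<close>
definition max_abs_entry :: "real^'c^'r \<Rightarrow> real" where
  "max_abs_entry M = Max {\<bar>M $ i $ j\<bar> | i j. True}"

definition vec_sup_norm :: "real^'n \<Rightarrow> real" where
  "vec_sup_norm v = Max (range (\<lambda>i. \<bar>v $ i\<bar>))"

definition vec_l1_norm :: "real^'n \<Rightarrow> real" where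
  "vec_l1_norm v = (\<Sum>i\<in>UNIV. \<bar>v $ i\<bar>)"

text \<open>An arbitrary norm on a real vector space.\<close>
definition is_norm :: "('a::real_vector \<Rightarrow> real) \<Rightarrow> bool" where
  "is_norm n \<longleftrightarrow> (\<forall>x. 0 \<le> n x) \<and> (\<forall>x. n x = 0 \<longleftrightarrow> x = 0)
     \<and> (\<forall>c x. n (c *\<^sub>R x) = \<bar>c\<bar> * n x) \<and> (\<forall>x y. n (x + y) \<le> n x + n y)"

text \<open>Neyman lambda near-orthogonality for a single N (score psi, norm nrm used for the
  pathwise derivative, realization set T, bound lam).\<close>
definition neyman_near_orth ::
  "'w measure \<Rightarrow> ('w \<Rightarrow> 'th \<Rightarrow> 'e::real_vector \<Rightarrow> 'v::{banach,second_countable_topology})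
    \<Rightarrow> ('v \<Rightarrow> real) \<Rightarrow> 'th \<Rightarrow> 'e \<Rightarrow> 'e set \<Rightarrow> real \<Rightarrow> bool" where
  "neyman_near_orth P psi nrm th0 eta0 T lam \<longleftrightarrow>
     (\<integral>w. psi w th0 eta0 \<partial>P) = 0
   \<and> (\<forall>eta\<in>T. \<forall>r\<in>{0..<1}. \<exists>D.
        ((\<lambda>s. \<integral>w. psi w th0 (eta0 + s *\<^sub>R (eta - eta0)) \<partial>P) has_vector_derivative D)
          (at r within {0..<1}))
   \<and> (\<forall>eta\<in>T. \<forall>D.
        ((\<lambda>s. \<integral>w. psi w th0 (eta0 + s *\<^sub>R (eta - eta0)) \<partial>P) has_vector_derivative D)
          (at 0 within {0..<1}) \<longrightarrow> nrm D \<le> lam)"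

text \<open>Neyman near-orthogonality along a sequence: lam positive, lam = o(N^(-1/2)),
  and the condition holds for every N w.r.t. T N (the true nuisance eta0 N may
  depend on N, as gamma0 depends on r_N).\<close>
definition neyman_near_orth_seq ::
  "'w measure \<Rightarrow> ('w \<Rightarrow> 'th \<Rightarrow> 'e::real_vector \<Rightarrow> 'v::{banach,second_countable_topology})
    \<Rightarrow> ('v \<Rightarrow> real) \<Rightarrow> 'th \<Rightarrow> (nat \<Rightarrow> 'e) \<Rightarrow> (nat \<Rightarrow> 'e set) \<Rightarrow> (nat \<Rightarrow> real) \<Rightarrow> bool" where
  "neyman_near_orth_seq P psi nrm th0 eta0 T lam \<longleftrightarrow>
     (\<forall>N. lam N > 0) \<and> lam \<in> o(\<lambda>N. 1 / sqrt (real N))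
   \<and> (\<forall>N. neyman_near_orth P psi nrm th0 (eta0 N) (T N) (lam N))"

end

theory Submission
  imports Defs
begin

(* The score is linear in the weight mu, so along the path from eta0 towards (beta, mu) its
   derivative at 0 is mu0 G (beta - beta0): the contribution of mu - mu0 is multiplied by
   E m(beta0) = 0.  With S the symmetric square root of Omega^-1 and L = S G, the choice of mu0
   gives mu0 G = A' S L - gamma0 L' L, whose entries are at most r_N because gamma0 is feasible.  Hence the sup-norm of the derivative is at most
   r_N |beta - beta0|_1 <= lambda_N.  Identifying inv_sqrt_mat Omega with a square root of
   Omega^-1 needs existence and uniqueness of positive definite square roots, which follow from
   the spectral theorem; eigenvectors are obtained by maximising the Rayleigh quotient. *)

section \<open>Spectral theorem for self-adjoint operators\<close>

definition self_adjoint :: "('a::real_inner \<Rightarrow> 'a) \<Rightarrow> bool" where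
  "self_adjoint f \<longleftrightarrow> (\<forall>x y. x \<bullet> f y = f x \<bullet> y)"

lemma self_adjoint_matrix_iff: "self_adjoint ((*v) M) \<longleftrightarrow> transpose M = (M :: real^'n^'n)"
proof
  assume "self_adjoint ((*v) M)"
  then have "(transpose M *v x - M *v x) \<bullet> y = 0" for x y
    by (simp add: self_adjoint_def inner_diff_left dot_lmul_matrix[symmetric])
  then have "transpose M *v x = M *v x" for x
    by (metis inner_eq_zero_iff right_minus_eq)
  then show "transpose M = M" by (simp add: matrix_eq)
next
  assume "transpose M = M"
  then show "self_adjoint ((*v) M)"
    by (metis self_adjoint_def dot_lmul_matrix transpose_matrix_vector)
qed

lemma pos_def_mat_iff:
  "pos_def_mat M \<longleftrightarrow> self_adjoint ((*v) M) \<and> (\<forall>x. x \<noteq> 0 \<longrightarrow> 0 < x \<bullet> (M *v x))"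
  by (simp add: pos_def_mat_def self_adjoint_matrix_iff)

lemma linear_coeff_zero_if_quadratic_nonpos:
  fixes a b :: real
  assumes "\<And>t. t * a + t\<^sup>2 * b \<le> 0"
  shows "a = 0"
proof (rule ccontr)
  assume "a \<noteq> 0"
  define t where "t = a / (2 * (\<bar>b\<bar> + 1))"
  have "\<bar>t\<bar> * \<bar>b\<bar> \<le> \<bar>a\<bar> / 2"
    by (simp add: t_def abs_divide field_simps)
  then have "\<bar>t\<^sup>2 * b\<bar> \<le> \<bar>t\<bar> * (\<bar>a\<bar> / 2)"
    by (simp add: power2_eq_square abs_mult mult.assoc mult_left_mono)
  moreover have "t * a = \<bar>t\<bar> * \<bar>a\<bar>" "0 < \<bar>t\<bar> * \<bar>a\<bar>"
    using \<open>a \<noteq> 0\<close> by (auto simp: t_def abs_mult abs_divide field_simps zero_less_mult_iff)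
  ultimately have "0 < t * a + t\<^sup>2 * b" by linarith
  with assms[of t] show False by simp
qed

lemma rayleigh_maximizer_is_eigenvector:
  fixes f :: "'a::real_inner \<Rightarrow> 'a"
  assumes f: "linear f" "self_adjoint f"
    and V: "subspace V" "\<And>x. x \<in> V \<Longrightarrow> f x \<in> V"
    and v: "v \<in> V" "v \<bullet> v = 1"
    and max: "\<And>x. x \<in> V \<Longrightarrow> x \<bullet> f x \<le> (v \<bullet> f v) * (x \<bullet> x)"
  shows "f v = (v \<bullet> f v) *\<^sub>R v"
proof -
  define c where "c = v \<bullet> f v"
  define u where "u = f v - c *\<^sub>R v"
  have "u \<in> V" using V v by (simp add: u_def subspace_diff subspace_scale)
  have uv: "u \<bullet> v = 0"
    using v(2) by (simp add: u_def c_def inner_diff_left inner_commute[of "f v" v])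
  have ufv: "u \<bullet> f v = u \<bullet> u"
    using uv by (simp add: u_def inner_diff_right inner_diff_left)
  \<comment> \<open>maximality of the Rayleigh quotient at v, tested along v + t u\<close>
  have "t * (2 * (u \<bullet> u)) + t\<^sup>2 * (u \<bullet> f u - c * (u \<bullet> u)) \<le> 0" for t
  proof -
    have "v + t *\<^sub>R u \<in> V" using V \<open>u \<in> V\<close> v by (simp add: subspace_add subspace_scale)
    from max[OF this] have "(v + t *\<^sub>R u) \<bullet> f (v + t *\<^sub>R u) \<le> c * ((v + t *\<^sub>R u) \<bullet> (v + t *\<^sub>R u))"
      by (simp add: c_def)
    moreover have "u \<bullet> f v = v \<bullet> f u"
      using f(2) by (simp add: self_adjoint_def inner_commute)
    ultimately show ?thesis
      using ufv uv v(2)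
      by (simp add: linear_add[OF f(1)] linear_scale[OF f(1)] inner_add_left inner_add_right
          inner_commute c_def power2_eq_square algebra_simps)
  qed
  then have "2 * (u \<bullet> u) = 0" by (rule linear_coeff_zero_if_quadratic_nonpos)
  then show ?thesis by (simp add: u_def c_def)
qed

lemma self_adjoint_unit_eigenvector:
  fixes f :: "'a::euclidean_space \<Rightarrow> 'a"
  assumes f: "linear f" "self_adjoint f"
    and V: "subspace V" "\<And>x. x \<in> V \<Longrightarrow> f x \<in> V" "V \<noteq> {0}"
  obtains v where "v \<in> V" "norm v = 1" "f v = (v \<bullet> f v) *\<^sub>R v"
proof -
  let ?K = "sphere 0 1 \<inter> V"
  obtain x where "x \<in> V" "x \<noteq> 0" using V subspace_0 by blast
  then have "x /\<^sub>R norm x \<in> ?K" using V(1) by (simp add: subspace_scale)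
  moreover have "compact ?K" using V(1) by (simp add: closed_subspace compact_Int_closed)
  moreover have "continuous_on ?K (\<lambda>x. x \<bullet> f x)"
    using linear_continuous_on[OF linear_conv_bounded_linear[THEN iffD1, OF f(1)]]
    by (intro continuous_intros) auto
  ultimately obtain v where v: "v \<in> ?K" and vmax: "\<And>y. y \<in> ?K \<Longrightarrow> y \<bullet> f y \<le> v \<bullet> f v"
    using continuous_attains_sup[of ?K "\<lambda>x. x \<bullet> f x"] by blast
  have "x \<bullet> f x \<le> (v \<bullet> f v) * (x \<bullet> x)" if "x \<in> V" for x
  proof (cases "x = 0")
    case False
    have "x /\<^sub>R norm x \<in> ?K" using False that V(1) by (simp add: subspace_scale)
    from vmax[OF this] have "(x \<bullet> f x) / (norm x)\<^sup>2 \<le> v \<bullet> f v"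
      by (simp add: linear_scale[OF f(1)] power2_eq_square field_simps)
    then show ?thesis using False by (simp add: divide_le_eq power2_norm_eq_inner mult.commute)
  qed (simp add: linear_0[OF f(1)])
  then have "f v = (v \<bullet> f v) *\<^sub>R v"
    using v by (intro rayleigh_maximizer_is_eigenvector[OF f V(1,2)]) (auto simp: dot_square_norm)
  with v that show thesis by auto
qed

lemma self_adjoint_orthonormal_eigenbasis_subspace:
  fixes f :: "'a::euclidean_space \<Rightarrow> 'a"
  assumes f: "linear f" "self_adjoint f"
  shows "subspace V \<Longrightarrow> (\<And>x. x \<in> V \<Longrightarrow> f x \<in> V) \<Longrightarrow>
    \<exists>B\<subseteq>V. pairwise orthogonal B \<and> (\<forall>b\<in>B. norm b = 1 \<and> f b = (b \<bullet> f b) *\<^sub>R b) \<and> V \<subseteq> span B"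
proof (induction "dim V" arbitrary: V rule: less_induct)
  case less
  show ?case
  proof (cases "V = {0}")
    case True
    then show ?thesis by (intro exI[of _ "{}"]) auto
  next
    case False
    then obtain v where v: "v \<in> V" "norm v = 1" and ev: "f v = (v \<bullet> f v) *\<^sub>R v"
      using self_adjoint_unit_eigenvector[OF f less.prems] by blast
    define V' where "V' = V \<inter> {x. orthogonal v x}"
    have "subspace V'"
      unfolding V'_def using less.prems(1) subspace_orthogonal_to_vector[of v] by (rule subspace_inter)
    moreover have "f x \<in> V'" if "x \<in> V'" for x
    proof -
      have "v \<bullet> f x = (v \<bullet> f v) * (v \<bullet> x)"
        using f(2) ev by (metis self_adjoint_def inner_scaleR_left)
      then show ?thesis using that less.prems(2) by (simp add: V'_def orthogonal_def)
    qed
    moreover have "dim V' < dim V"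
    proof (rule dim_psubset)
      have "v \<notin> V'" using v by (simp add: V'_def orthogonal_def dot_square_norm)
      then have "V' \<subset> V" using v(1) by (auto simp: V'_def)
      then show "span V' \<subset> span V"
        using \<open>subspace V'\<close> less.prems(1) by (metis span_eq_iff)
    qed
    ultimately obtain B where B: "B \<subseteq> V'" "pairwise orthogonal B"
        "\<forall>b\<in>B. norm b = 1 \<and> f b = (b \<bullet> f b) *\<^sub>R b" "V' \<subseteq> span B"
      using less.hyps by blast
    show ?thesis
    proof (intro exI[of _ "insert v B"] conjI)
      show "insert v B \<subseteq> V" "\<forall>b\<in>insert v B. norm b = 1 \<and> f b = (b \<bullet> f b) *\<^sub>R b"
        using B(1,3) v ev by (auto simp: V'_def)
      show "pairwise orthogonal (insert v B)"
        using B(1,2) by (intro pairwise_orthogonal_insert) (auto simp: V'_def)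
      show "V \<subseteq> span (insert v B)"
      proof
        fix x assume "x \<in> V"
        then have "x - (v \<bullet> x) *\<^sub>R v \<in> V'"
          using v less.prems(1)
          by (simp add: V'_def orthogonal_def subspace_diff subspace_scale inner_diff_right dot_square_norm)
        then have "x - (v \<bullet> x) *\<^sub>R v \<in> span (insert v B)"
          using B(4) span_mono[of B "insert v B"] by blast
        then show "x \<in> span (insert v B)"
          by (metis diff_add_cancel span_add span_base span_mul insertI1)
      qed
    qed
  qed
qed

lemma self_adjoint_orthonormal_eigenbasis:
  fixes f :: "'a::euclidean_space \<Rightarrow> 'a"
  assumes "linear f" "self_adjoint f"
  obtains B where "finite B" "pairwise orthogonal B" "\<And>b. b \<in> B \<Longrightarrow> norm b = 1"
    "\<And>b. b \<in> B \<Longrightarrow> f b = (b \<bullet> f b) *\<^sub>R b" "\<And>x. (\<Sum>b\<in>B. (x \<bullet> b) *\<^sub>R b) = x"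
proof -
  obtain B where B: "pairwise orthogonal B" "\<forall>b\<in>B. norm b = 1 \<and> f b = (b \<bullet> f b) *\<^sub>R b"
      "UNIV \<subseteq> span B"
    using self_adjoint_orthonormal_eigenbasis_subspace[OF assms, of UNIV] by auto
  moreover have "finite B" using B(1) by (rule pairwise_orthogonal_imp_finite)
  ultimately show thesis
    using that orthonormal_basis_expand[of B] by blast
qed

lemma inner_orthonormal_sum:
  assumes "finite B" "pairwise orthogonal B" "\<And>b. b \<in> B \<Longrightarrow> norm b = 1" "b \<in> B"
  shows "b \<bullet> (\<Sum>b'\<in>B. c b' *\<^sub>R b') = c b"
proof -
  have "b \<bullet> (\<Sum>b'\<in>B. c b' *\<^sub>R b') = (\<Sum>b'\<in>B. if b' = b then c b else 0)"
    unfolding inner_sum_right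
    using assms(2-4) by (intro sum.cong) (auto simp: pairwise_def orthogonal_def dot_square_norm)
  also have "\<dots> = c b" using assms(1,4) by simp
  finally show ?thesis .
qed

section \<open>Positive definite square roots\<close>

lemma pos_def_mat_sqrt_exists:
  fixes Q :: "real^'n^'n"
  assumes Q: "pos_def_mat Q"
  obtains S where "pos_def_mat S" "S ** S = Q"
proof -
  obtain B where fin: "finite B" and orth: "pairwise orthogonal B" and unit: "\<And>b. b \<in> B \<Longrightarrow> norm b = 1"
    and eigen: "\<And>b. b \<in> B \<Longrightarrow> Q *v b = (b \<bullet> (Q *v b)) *\<^sub>R b"
    and expand: "\<And>x. (\<Sum>b\<in>B. (x \<bullet> b) *\<^sub>R b) = x"
    by (rule self_adjoint_orthonormal_eigenbasis[of "(*v) Q"]) (use Q in \<open>simp_all add: pos_def_mat_iff\<close>)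
  have eigen_pos: "0 < b \<bullet> (Q *v b)" if "b \<in> B" for b
    using Q unit[OF that] unfolding pos_def_mat_iff by (metis norm_zero zero_neq_one)
  define s where "s b = sqrt (b \<bullet> (Q *v b))" for b
  define f where "f x = (\<Sum>b\<in>B. (s b * (x \<bullet> b)) *\<^sub>R b)" for x
  have "linear f"
    by (rule linearI) (simp_all add: f_def inner_add_left distrib_left scaleR_add_left sum.distrib
        scaleR_sum_right mult.left_commute)
  define S where "S = matrix f"
  have S: "S *v x = f x" for x
    using matrix_vector_mul(2)[OF \<open>linear f\<close>] unfolding S_def by metis
  have coeff: "f x \<bullet> b = s b * (x \<bullet> b)" if "b \<in> B" for b x
    using inner_orthonormal_sum[OF fin orth unit that, of "\<lambda>b. s b * (x \<bullet> b)"]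
    by (metis f_def inner_commute)
  have "pos_def_mat S"
    unfolding pos_def_mat_iff self_adjoint_def
  proof (intro conjI allI impI)
    show "x \<bullet> (S *v y) = (S *v x) \<bullet> y" for x y
      by (simp add: S f_def inner_sum_right inner_sum_left inner_commute mult.commute mult.left_commute)
  next
    fix x :: "real^'n"
    assume "x \<noteq> 0"
    have "\<exists>b\<in>B. x \<bullet> b \<noteq> 0"
    proof (rule ccontr)
      assume "\<not> (\<exists>b\<in>B. x \<bullet> b \<noteq> 0)"
      then have "(\<Sum>b\<in>B. (x \<bullet> b) *\<^sub>R b) = 0" by simp
      with \<open>x \<noteq> 0\<close> show False by (simp add: expand)
    qed
    then obtain b where b: "b \<in> B" "x \<bullet> b \<noteq> 0" by blast
    have "0 < s b * (x \<bullet> b)\<^sup>2" using eigen_pos[OF b(1)] b(2) by (simp add: s_def)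
    also have "\<dots> \<le> (\<Sum>b\<in>B. s b * (x \<bullet> b)\<^sup>2)"
      using eigen_pos fin b(1) by (intro member_le_sum) (auto simp: s_def less_imp_le)
    also have "\<dots> = x \<bullet> (S *v x)"
      by (simp add: S f_def inner_sum_right inner_commute power2_eq_square mult.commute mult.left_commute)
    finally show "0 < x \<bullet> (S *v x)" .
  qed
  moreover have "S *v (S *v x) = Q *v x" for x
  proof -
    have "S *v (S *v x) = (\<Sum>b\<in>B. (x \<bullet> b) *\<^sub>R ((s b * s b) *\<^sub>R b))"
      unfolding S f_def[of "f x"] by (intro sum.cong) (simp_all add: coeff)
    also have "\<dots> = (\<Sum>b\<in>B. (x \<bullet> b) *\<^sub>R (Q *v b))"
      using eigen eigen_pos by (intro sum.cong) (simp_all add: s_def less_imp_le)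
    also have "\<dots> = Q *v (\<Sum>b\<in>B. (x \<bullet> b) *\<^sub>R b)"
      by (simp add: vec.sum matrix_vector_mult_scaleR)
    also have "\<dots> = Q *v x" by (simp only: expand)
    finally show ?thesis .
  qed
  then have "S ** S = Q" by (simp add: matrix_eq matrix_vector_mul_assoc)
  ultimately show thesis by (rule that)
qed

lemma pos_def_mat_sqrt_unique:
  fixes S T :: "real^'n^'n"
  assumes S: "pos_def_mat S" and T: "pos_def_mat T" and eq: "S ** S = T ** T"
  shows "S = T"
proof -
  define D where "D = S - T"
  have "self_adjoint ((*v) D)"
    using S T by (simp add: pos_def_mat_iff self_adjoint_def D_def matrix_vector_mult_diff_rdistrib
        inner_diff_left inner_diff_right)
  then obtain B where unit: "\<And>b. b \<in> B \<Longrightarrow> norm b = 1"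
    and eigen: "\<And>b. b \<in> B \<Longrightarrow> D *v b = (b \<bullet> (D *v b)) *\<^sub>R b"
    and expand: "\<And>x. (\<Sum>b\<in>B. (x \<bullet> b) *\<^sub>R b) = x"
    by (rule self_adjoint_orthonormal_eigenbasis[OF matrix_vector_mul_linear]) blast+
  have eigen_zero: "D *v b = 0" if b: "b \<in> B" for b
  proof -
    define \<mu> where "\<mu> = b \<bullet> (D *v b)"
    \<comment> \<open>S D + D T = S S - T T = 0; testing it against the eigenvector b of D gives
       \<mu> (b' S b + b' T b) = 0, and the second factor is positive.\<close>
    have "S *v (D *v b) + D *v (T *v b) = (S ** S) *v b - (T ** T) *v b"
      by (simp add: D_def matrix_vector_mult_diff_rdistrib matrix_vector_mult_diff_distrib
          matrix_vector_mul_assoc[symmetric])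
    then have "S *v (D *v b) + D *v (T *v b) = 0" by (simp add: eq)
    then have "0 = b \<bullet> (S *v (D *v b)) + (D *v b) \<bullet> (T *v b)"
      using \<open>self_adjoint ((*v) D)\<close> by (metis inner_add_right inner_zero_right self_adjoint_def)
    also have "\<dots> = \<mu> * (b \<bullet> (S *v b) + b \<bullet> (T *v b))"
      using eigen[OF b] S unfolding \<mu>_def[symmetric]
      by (simp add: matrix_vector_mult_scaleR distrib_left pos_def_mat_iff self_adjoint_def)
    finally have "\<mu> * (b \<bullet> (S *v b) + b \<bullet> (T *v b)) = 0" ..
    moreover have "0 < b \<bullet> (S *v b) + b \<bullet> (T *v b)"
    proof -
      have "b \<noteq> 0" using unit[OF b] by auto
      then show ?thesis using S T by (simp add: pos_def_mat_iff add_pos_pos)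
    qed
    ultimately show ?thesis using eigen[OF b] by (simp add: \<mu>_def)
  qed
  have "D *v x = 0" for x
  proof -
    have "D *v x = D *v (\<Sum>b\<in>B. (x \<bullet> b) *\<^sub>R b)" by (simp only: expand)
    also have "\<dots> = 0" by (simp add: vec.sum matrix_vector_mult_scaleR eigen_zero)
    finally show ?thesis .
  qed
  then show ?thesis by (simp add: D_def matrix_eq matrix_vector_mult_diff_rdistrib)
qed

lemma pos_def_mat_invertible:
  assumes "pos_def_mat (M :: real^'n^'n)"
  shows "invertible M"
proof -
  have "x = 0" if "M *v x = 0" for x
    using assms that by (auto simp: pos_def_mat_iff)
  then show ?thesis by (metis invertible_left_inverse matrix_left_invertible_ker)
qed

lemma matrix_inv_invertible:
  assumes "invertible (M :: real^'n^'n)"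
  shows "M ** matrix_inv M = mat 1" "matrix_inv M ** M = mat 1"
  using someI_ex[OF assms[unfolded invertible_def]] by (simp_all add: matrix_inv_def)

lemma pos_def_mat_matrix_inv:
  assumes M: "pos_def_mat (M :: real^'n^'n)"
  shows "pos_def_mat (matrix_inv M)"
proof -
  let ?I = "matrix_inv M"
  have right_inv: "M *v (?I *v x) = x" for x
    using matrix_inv_invertible(1)[OF pos_def_mat_invertible[OF M]] by (simp add: matrix_vector_mul_assoc)
  have "x \<bullet> (?I *v y) = (?I *v x) \<bullet> y" for x y
    using M by (metis pos_def_mat_iff self_adjoint_def right_inv)
  moreover have "0 < x \<bullet> (?I *v x)" if "x \<noteq> 0" for x
  proof -
    have "?I *v x \<noteq> 0" using that right_inv[of x] by auto
    then have "0 < (?I *v x) \<bullet> (M *v (?I *v x))" using M by (simp add: pos_def_mat_iff)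
    then show ?thesis by (simp add: right_inv inner_commute)
  qed
  ultimately show ?thesis by (simp add: pos_def_mat_iff self_adjoint_def)
qed

lemma inv_sqrt_mat_square:
  assumes "pos_def_mat (M :: real^'n^'n)"
  shows "inv_sqrt_mat M ** inv_sqrt_mat M = matrix_inv M"
proof -
  have "\<exists>!S. pos_def_mat S \<and> S ** S = matrix_inv M"
    using pos_def_mat_sqrt_exists[OF pos_def_mat_matrix_inv[OF assms]] pos_def_mat_sqrt_unique by metis
  then show ?thesis unfolding inv_sqrt_mat_def by (rule theI'[THEN conjunct2])
qed

section \<open>Near-orthogonality of scores linear in the weight matrix\<close>

lemma vec_sup_norm_matrix_vector_le:
  fixes C :: "real^'n^'m"
  shows "vec_sup_norm (C *v h) \<le> max_abs_entry C * vec_l1_norm h"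
proof -
  have "\<bar>C $ i $ j\<bar> \<le> max_abs_entry C" for i j
  proof -
    have "{\<bar>C $ i $ j\<bar> | i j. True} = (\<lambda>(i, j). \<bar>C $ i $ j\<bar>) ` UNIV" by auto
    then show ?thesis unfolding max_abs_entry_def by (metis (mono_tags) Max_ge finite_imageI finite rangeI case_prod_conv)
  qed
  then have "\<bar>(C *v h) $ i\<bar> \<le> max_abs_entry C * vec_l1_norm h" for i
    unfolding matrix_vector_mult_def vec_l1_norm_def sum_distrib_left
    by (auto intro!: order_trans[OF sum_abs] sum_mono simp: abs_mult mult_right_mono)
  then show ?thesis unfolding vec_sup_norm_def by (simp add: Max_le_iff)
qed

lemma has_vector_derivative_matrix_path:
  fixes f :: "real^'n \<Rightarrow> real^'m" and M0 M1 :: "real^'m^'k"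
  assumes f: "(f has_derivative f') (at (b0 + r *\<^sub>R d) within B)"
    and path: "(\<lambda>s. b0 + s *\<^sub>R d) ` S \<subseteq> B"
  shows "((\<lambda>s. (M0 + s *\<^sub>R M1) *v f (b0 + s *\<^sub>R d)) has_vector_derivative
          (M0 + r *\<^sub>R M1) *v f' d + M1 *v f (b0 + r *\<^sub>R d)) (at r within S)"
proof -
  have "((\<lambda>s. b0 + s *\<^sub>R d) has_vector_derivative d) (at r within S)"
    by (auto intro!: derivative_eq_intros)
  from vector_derivative_diff_chain_within[OF this has_derivative_subset[OF f path]]
  have "((\<lambda>s. f (b0 + s *\<^sub>R d)) has_vector_derivative f' d) (at r within S)"
    by (simp add: o_def)
  then have lin: "((\<lambda>s. M *v f (b0 + s *\<^sub>R d)) has_vector_derivative M *v f' d) (at r within S)"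
    for M :: "real^'m^'k"
    using vector_derivative_diff_chain_within[OF _ matrix_vector_mul_bounded_linear[THEN
          bounded_linear_imp_has_derivative]]
    by (simp add: o_def)
  have "((\<lambda>s. M0 *v f (b0 + s *\<^sub>R d) + s *\<^sub>R (M1 *v f (b0 + s *\<^sub>R d))) has_vector_derivative
      M0 *v f' d + (r *\<^sub>R (M1 *v f' d) + 1 *\<^sub>R (M1 *v f (b0 + r *\<^sub>R d)))) (at r within S)"
    by (intro has_vector_derivative_add has_vector_derivative_scaleR lin DERIV_ident)
  then show ?thesis
    by (simp add: matrix_vector_mult_add_rdistrib scaleR_matrix_vector_assoc add.assoc)
qed

lemma convex_line_path_subset:
  assumes "convex B" "b0 \<in> B" "b \<in> B"
  shows "(\<lambda>s. b0 + s *\<^sub>R (b - b0)) ` {0..1} \<subseteq> B"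
proof clarify
  fix s :: real
  assume "s \<in> {0..1}"
  then have "(1 - s) *\<^sub>R b0 + s *\<^sub>R b \<in> B" using convexD_alt[OF assms] by simp
  then show "b0 + s *\<^sub>R (b - b0) \<in> B" by (simp add: algebra_simps)
qed

lemma linear_score_mean_has_vector_derivative:
  fixes P :: "'w measure" and m :: "'w \<Rightarrow> real^'b \<Rightarrow> real^'m"
    and beta0 beta :: "real^'b" and mu0 mu :: "real^'m^'t"
  defines "Mf \<equiv> \<lambda>b. \<integral>w. m w b \<partial>P"
  defines "eta0 \<equiv> (beta0, mu0)" and "eta \<equiv> (beta, mu)"
  assumes B: "convex B" "beta0 \<in> B" "beta \<in> B"
    and integrable: "\<And>b. b \<in> B \<Longrightarrow> integrable P (\<lambda>w. m w b)"
    and r: "r \<in> {0..<1}"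
    and Md: "(Mf has_derivative Md) (at (beta0 + r *\<^sub>R (beta - beta0)) within B)"
  shows "((\<lambda>s. \<integral>w. snd (eta0 + s *\<^sub>R (eta - eta0)) *v m w (fst (eta0 + s *\<^sub>R (eta - eta0))) \<partial>P)
    has_vector_derivative (mu0 + r *\<^sub>R (mu - mu0)) *v Md (beta - beta0) + (mu - mu0) *v Mf (beta0 + r *\<^sub>R (beta - beta0)))
    (at r within {0..<1})"
proof (rule has_vector_derivative_transform_within[OF _ zero_less_one r])
  have path: "(\<lambda>s. beta0 + s *\<^sub>R (beta - beta0)) ` {0..<1} \<subseteq> B"
    using convex_line_path_subset[OF B] by fastforce
  then show "((\<lambda>s. (mu0 + s *\<^sub>R (mu - mu0)) *v Mf (beta0 + s *\<^sub>R (beta - beta0))) has_vector_derivative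
      (mu0 + r *\<^sub>R (mu - mu0)) *v Md (beta - beta0) + (mu - mu0) *v Mf (beta0 + r *\<^sub>R (beta - beta0)))
      (at r within {0..<1})"
    by (rule has_vector_derivative_matrix_path[OF Md])
  fix s :: real
  assume "s \<in> {0..<1}"
  then have "beta0 + s *\<^sub>R (beta - beta0) \<in> B" using path by blast
  from integral_bounded_linear[OF matrix_vector_mul_bounded_linear[of "mu0 + s *\<^sub>R (mu - mu0)"]
      integrable[OF this]]
  show "(mu0 + s *\<^sub>R (mu - mu0)) *v Mf (beta0 + s *\<^sub>R (beta - beta0))
      = (\<integral>w. snd (eta0 + s *\<^sub>R (eta - eta0)) *v m w (fst (eta0 + s *\<^sub>R (eta - eta0))) \<partial>P)"
    by (simp add: Mf_def eta0_def eta_def)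
qed

lemma at_left_endpoint_within_Ico_nontrivial:
  fixes a b :: real
  assumes "a < b"
  shows "at a within {a..<b} \<noteq> bot"
proof -
  have "{a..<b} - {a} = {a<..<b}" by auto
  then have "closure ({a..<b} - {a}) = {a..b}" using assms by simp
  then show ?thesis using assms by (simp add: at_within_eq_bot_iff)
qed

lemma neyman_near_orth_linear_score:
  fixes P :: "'w measure" and m :: "'w \<Rightarrow> 'th \<Rightarrow> real^'b \<Rightarrow> real^'m" and theta0 :: 'th
    and G :: "real^'b^'m" and mu0 :: "real^'m^'t"
  defines "Mf \<equiv> \<lambda>b. \<integral>w. m w theta0 b \<partial>P"
  assumes B: "convex B" "beta0 \<in> B"
    and integrable: "\<And>beta. beta \<in> B \<Longrightarrow> integrable P (\<lambda>w. m w theta0 beta)"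
    and zero: "Mf beta0 = 0"
    and differentiable: "\<And>beta. beta \<in> B \<Longrightarrow> Mf differentiable (at beta within B)"
    and G: "(Mf has_derivative (\<lambda>h. G *v h)) (at beta0 within B)"
    and r: "max_abs_entry (mu0 ** G) \<le> r" "0 < r"
  shows "neyman_near_orth P (\<lambda>w theta (eta :: (real^'b) \<times> (real^'m^'t)). snd eta *v m w theta (fst eta))
           vec_sup_norm theta0 (beta0, mu0) ({beta \<in> B. vec_l1_norm (beta - beta0) \<le> lam / r} \<times> UNIV) lam"
  unfolding neyman_near_orth_def
proof (intro conjI ballI allI impI)
  show "(\<integral>w. snd (beta0, mu0) *v m w theta0 (fst (beta0, mu0)) \<partial>P) = 0"
    using integral_bounded_linear[OF matrix_vector_mul_bounded_linear integrable[OF B(2)]] zero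
    by (simp add: Mf_def)
next
  fix eta :: "(real^'b) \<times> (real^'m^'t)" and s :: real
  assume "eta \<in> {beta \<in> B. vec_l1_norm (beta - beta0) \<le> lam / r} \<times> UNIV" "s \<in> {0..<1}"
  moreover from this obtain beta mu where eta: "eta = (beta, mu)" and "beta \<in> B" by auto
  moreover have "beta0 + s *\<^sub>R (beta - beta0) \<in> B"
    using convex_line_path_subset[OF B \<open>beta \<in> B\<close>] \<open>s \<in> {0..<1}\<close> by fastforce
  then obtain Md where "(Mf has_derivative Md) (at (beta0 + s *\<^sub>R (beta - beta0)) within B)"
    using differentiable by (meson differentiable_def)
  ultimately show "\<exists>D. ((\<lambda>s. \<integral>w. snd ((beta0, mu0) + s *\<^sub>R (eta - (beta0, mu0))) *v
      m w theta0 (fst ((beta0, mu0) + s *\<^sub>R (eta - (beta0, mu0)))) \<partial>P) has_vector_derivative D)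
      (at s within {0..<1})"
    using linear_score_mean_has_vector_derivative[where m = "\<lambda>w. m w theta0", OF B \<open>beta \<in> B\<close> integrable]
    unfolding Mf_def by blast
next
  fix eta :: "(real^'b) \<times> (real^'m^'t)" and D
  assume eta: "eta \<in> {beta \<in> B. vec_l1_norm (beta - beta0) \<le> lam / r} \<times> UNIV"
    and D: "((\<lambda>s. \<integral>w. snd ((beta0, mu0) + s *\<^sub>R (eta - (beta0, mu0))) *v
      m w theta0 (fst ((beta0, mu0) + s *\<^sub>R (eta - (beta0, mu0)))) \<partial>P) has_vector_derivative D)
      (at 0 within {0..<1})"
  obtain beta mu where eta_eq: "eta = (beta, mu)" and "beta \<in> B"
    and l1: "vec_l1_norm (beta - beta0) \<le> lam / r"
    using eta by auto
  have "D = (mu0 ** G) *v (beta - beta0)"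
    by (rule vector_derivative_unique_within[OF at_left_endpoint_within_Ico_nontrivial[OF zero_less_one] D])
      (use linear_score_mean_has_vector_derivative[where m = "\<lambda>w. m w theta0" and r = 0 and Md = "(*v) G",
        OF B \<open>beta \<in> B\<close> integrable] G zero
        in \<open>simp add: eta_eq Mf_def matrix_vector_mul_assoc\<close>)
  also have "vec_sup_norm \<dots> \<le> r * (lam / r)"
  proof (rule order_trans[OF vec_sup_norm_matrix_vector_le mult_mono])
    show "0 \<le> vec_l1_norm (beta - beta0)" by (simp add: vec_l1_norm_def sum_nonneg)
  qed (use r l1 in auto)
  finally show "vec_sup_norm D \<le> lam" using r by simp
qed

lemma inv_sqrt_mat_weight_mul_jacobian:
  fixes Omega :: "real^'m^'m" and A :: "real^'t^'m" and G :: "real^'b^'m" and gamma :: "real^'b^'t"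
  assumes "pos_def_mat Omega"
  defines "S \<equiv> inv_sqrt_mat Omega"
  defines "L \<equiv> S ** G"
  shows "(transpose A ** matrix_inv Omega - gamma ** transpose L ** S) ** G
    = transpose A ** S ** L - gamma ** (transpose L ** L)"
proof -
  have "matrix_inv Omega = S ** S" using inv_sqrt_mat_square[OF assms(1)] by (simp add: S_def)
  then show ?thesis
    by (simp add: matrix_eq L_def matrix_vector_mult_diff_rdistrib matrix_vector_mul_assoc[symmetric])
qed

theorem lemma2p4:
  fixes P :: "'w measure"
    and Theta :: "(real^'t) set" and B :: "(real^'b) set"
    and m :: "'w \<Rightarrow> real^'t \<Rightarrow> real^'b \<Rightarrow> real^'m"
    and theta0 :: "real^'t" and beta0 :: "real^'b"
    and G :: "real^'b^'m" and Omega :: "real^'m^'m" and A :: "real^'t^'m"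
    and nrm_o :: "real^'b^'t \<Rightarrow> real"
    and rN :: "nat \<Rightarrow> real" and lam :: "nat \<Rightarrow> real"
    and gamma0 :: "nat \<Rightarrow> real^'b^'t"
  assumes "prob_space P"
    and "theta0 \<in> Theta" and "beta0 \<in> B" and "convex B"
    and "\<forall>beta\<in>B. integrable P (\<lambda>w. m w theta0 beta)"
    and "(\<integral>w. m w theta0 beta0 \<partial>P) = 0"
    and "\<forall>beta\<in>B. (\<lambda>b. \<integral>w. m w theta0 b \<partial>P) differentiable (at beta within B)"
    and "((\<lambda>b. \<integral>w. m w theta0 b \<partial>P) has_derivative (\<lambda>h. G *v h)) (at beta0 within B)"
    and "pos_def_mat Omega"
    and "is_norm nrm_o"
    and "\<forall>N. rN N > 0"
    and "\<forall>N. max_abs_entry (transpose A ** inv_sqrt_mat Omega ** (inv_sqrt_mat Omega ** G)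
               - gamma0 N ** (transpose (inv_sqrt_mat Omega ** G) ** (inv_sqrt_mat Omega ** G)))
             \<le> rN N"
    and "\<forall>N. \<forall>gamma. max_abs_entry (transpose A ** inv_sqrt_mat Omega ** (inv_sqrt_mat Omega ** G)
               - gamma ** (transpose (inv_sqrt_mat Omega ** G) ** (inv_sqrt_mat Omega ** G)))
             \<le> rN N \<longrightarrow> nrm_o (gamma0 N) \<le> nrm_o gamma"
    and "\<forall>N. lam N > 0" and "lam \<in> o(\<lambda>N. 1 / sqrt (real N))"
  shows "neyman_near_orth_seq P
           (\<lambda>w theta (eta :: (real^'b) \<times> (real^'m^'t)). snd eta *v m w theta (fst eta))
           vec_sup_norm theta0
           (\<lambda>N. (beta0, transpose A ** matrix_inv Omega
                   - gamma0 N ** transpose (inv_sqrt_mat Omega ** G) ** inv_sqrt_mat Omega))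
           (\<lambda>N. {beta \<in> B. vec_l1_norm (beta - beta0) \<le> lam N / rN N} \<times> UNIV)
           lam"
proof -
  have "neyman_near_orth P (\<lambda>w theta (eta :: (real^'b) \<times> (real^'m^'t)). snd eta *v m w theta (fst eta))
      vec_sup_norm theta0
      (beta0, transpose A ** matrix_inv Omega
        - gamma0 N ** transpose (inv_sqrt_mat Omega ** G) ** inv_sqrt_mat Omega)
      ({beta \<in> B. vec_l1_norm (beta - beta0) \<le> lam N / rN N} \<times> UNIV) (lam N)" for N
  proof (rule neyman_near_orth_linear_score)
    show "max_abs_entry ((transpose A ** matrix_inv Omega
        - gamma0 N ** transpose (inv_sqrt_mat Omega ** G) ** inv_sqrt_mat Omega) ** G) \<le> rN N"
      using assms(12) by (simp add: inv_sqrt_mat_weight_mul_jacobian[OF assms(9)])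
  qed (use assms in auto)
  then show ?thesis using assms(14,15) by (simp add: neyman_near_orth_seq_def)
qed

end
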